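(* Let $t\in\mathbb{N}$ with $t>1$. The Fourier series expansion of $L_t(z)$ at the cusp $1\in\mathbb{Q}$ is given by $$L_t(A_1^{-1}z)=(z+1)^2\left(E_2(z)-\frac1t E_2\!\left(\frac{z+1}{t}\right)\right)\qquad(z\in\mathbb{H}).$$ Let $p_1,p_2$ be primes. The Fourier series expansions of $L_{p_1p_2}(z)$ at the cusps $1/p_1,\,1/p_2\in\mathbb{Q}$ are given, respectively, by $$L_{p_1p_2}(A_{p_1}^{-1}z)=(p_1z+1)^2\left(E_2(z)-\frac{p_1}{p_2}E_2\!\left(\frac{p_1z+1}{p_2}\right)\right)\qquad(z\in\mathbb{H})$$ and $$L_{p_1p_2}(A_{p_2}^{-1}z)=(p_2z+1)^2\left(E_2(z)-\frac{p_2}{p_1}E_2\!\left(\frac{p_2z+1}{p_1}\right)\right)\qquad(z\in\mathbb{H}).$$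
   Context: $\mathbb{H}$ is the upper half plane, $q=e^{2\pi i z}$, $\mathbb{N}=\{1,2,3,\dots\}$. $\sigma(n)=\sum_{d\mid n}d$, $E_2(z)=1-24\sum_{n\ge1}\sigma(n)q^n$, and $L_d(z)=E_2(z)-d\,E_2(dz)$ for $d\in\mathbb{N}$. A matrix $M=\begin{pmatrix}a&b\\c&d\end{pmatrix}\in SL_2(\mathbb{Z})$ acts by $M(z)=\frac{az+b}{cz+d}$. For an integer $c$, $A_c=\begin{pmatrix}-1&0\\c&-1\end{pmatrix}$, so that $A_c^{-1}z=\frac{z}{cz+1}$. By definition, the Fourier series expansion of a modular form $f(z)$ at the cusp $1/c$ is the Fourier series expansion of $f(A_c^{-1}z)$ at $\infty$; so the content of the claim is the three displayed identities. *)

theory Defs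
  imports "HOL-Analysis.Analysis" "HOL-Computational_Algebra.Primes"
begin

definition upper_half_plane :: "complex set" where
  "upper_half_plane = {z. Im z > 0}"

definition divisor_sum :: "nat \<Rightarrow> nat" where
  "divisor_sum n = (\<Sum>d | d dvd n. d)"

definition q_of :: "complex \<Rightarrow> complex" where
  "q_of z = exp (2 * of_real pi * \<i> * z)"

text \<open>The series over \<open>n \<ge> 1\<close> is written with index \<open>Suc n\<close>. It converges absolutely for
  \<open>z\<close> in the upper half plane; elsewhere the value of \<open>E2\<close> is irrelevant.\<close>

definition E2 :: "complex \<Rightarrow> complex" where
  "E2 z = 1 - 24 * (\<Sum>n. of_nat (divisor_sum (Suc n)) * q_of z ^ Suc n)"

definition L :: "nat \<Rightarrow> complex \<Rightarrow> complex" where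
  "L d z = E2 z - of_nat d * E2 (of_nat d * z)"

text \<open>The action is defined for all integral matrices but only used for matrices of
  determinant 1.\<close>

definition moebius_act :: "int^2^2 \<Rightarrow> complex \<Rightarrow> complex" where
  "moebius_act M z =
     (of_int (M $ 1 $ 1) * z + of_int (M $ 1 $ 2)) / (of_int (M $ 2 $ 1) * z + of_int (M $ 2 $ 2))"

definition A_mat :: "int \<Rightarrow> int^2^2" where
  "A_mat c = vector [vector [-1, 0], vector [c, -1]]"

lemma det_A_mat: "det (A_mat c) = 1"
  by (simp add: A_mat_def det_2)

lemma matrix_inv_A_mat: "matrix_inv (A_mat c) = vector [vector [-1, 0], vector [-c, -1]]"
proof -
  let ?B = "vector [vector [-1, 0], vector [-c, -1]] :: int^2^2"
  have 1: "A_mat c ** ?B = mat 1" and 2: "?B ** A_mat c = mat 1"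
    by (simp_all add: A_mat_def matrix_matrix_mult_def mat_def vec_eq_iff sum_2 forall_2)
  then have "\<exists>B. A_mat c ** B = mat 1 \<and> B ** A_mat c = mat 1"
    by blast
  then have 3: "A_mat c ** matrix_inv (A_mat c) = mat 1"
    unfolding matrix_inv_def by (rule someI2_ex) blast
  have "matrix_inv (A_mat c) = (?B ** A_mat c) ** matrix_inv (A_mat c)"
    by (simp add: 2)
  also have "\<dots> = ?B"
    by (simp only: matrix_mul_assoc [symmetric] 3 matrix_mul_rid)
  finally show ?thesis .
qed

lemma moebius_act_matrix_inv_A_mat:
  "moebius_act (matrix_inv (A_mat c)) z = z / (of_int c * z + 1)"
proof -
  have "moebius_act (matrix_inv (A_mat c)) z = (- z) / (- (of_int c * z + 1))"
    by (simp add: moebius_act_def matrix_inv_A_mat)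
  then show ?thesis
    by (simp only: minus_divide_left [symmetric] minus_divide_right [symmetric] minus_minus)
qed

end

theory Submission
  imports Defs
begin

text \<open>
  Everything follows from \<open>E2 (- 1 / z) = z\<^sup>2 E2 z - (6 \<i> / \<pi>) z\<close> and the 1-periodicity of \<open>E2\<close>:
  they give the behaviour under \<open>z \<mapsto> z / (c z + 1)\<close>, and in \<open>L (c d)\<close> the two non-modular terms
  cancel.

  For the inversion formula, the partial fractions of \<open>\<pi>\<^sup>2 / sin\<^sup>2\<close> write \<open>(\<pi>\<^sup>2 / 3) E2 z\<close> as
  the iterated sum, first over \<open>n\<close> and then over \<open>m\<close>, of \<open>1 / (m z + n)\<^sup>2\<close> over
  \<open>(m, n) \<noteq> (0, 0)\<close>; summing in the other order gives \<open>(\<pi>\<^sup>2 / 3) E2 (- 1 / z) / z\<^sup>2\<close>.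
  Subtracting \<open>1 / (m z + n) - 1 / (m z + n + 1)\<close> makes the double series absolutely convergent.
  The correction telescopes to \<open>0\<close> when summed over \<open>n\<close> first, but in the other order it is
  a telescoping sum of cotangents with value \<open>- 2 \<pi> \<i> / z\<close>.
\<close>

section \<open>Sums over the integers\<close>

text \<open>The map \<open>\<lambda>n. -1 - int n\<close> enumerates the negative integers, so each
  half becomes a sum over the naturals, and 0 is counted once.\<close>

lemma has_sum_intI:
  fixes f :: "int \<Rightarrow> 'a :: topological_comm_monoid_add"
  assumes "((\<lambda>n. f (int n)) has_sum a) UNIV" "((\<lambda>n. f (-1 - int n)) has_sum b) UNIV"
  shows "(f has_sum (a + b)) UNIV"
proof -
  have "(f has_sum a) {0..}"
    using assms(1)
    by (subst has_sum_reindex_bij_witness[of "{0..}" int nat UNIV "\<lambda>n. f (int n)" f a a]) auto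
  moreover have "((\<lambda>n. f (-1 - int n)) has_sum b) UNIV = (f has_sum b) {..<0}"
    by (rule has_sum_reindex_bij_witness[of _ "\<lambda>n. nat (-1 - n)" "\<lambda>n. -1 - int n"]) auto
  ultimately have "(f has_sum (a + b)) ({0..} \<union> {..<0})"
    using assms by (intro has_sum_Un_disjoint) auto
  moreover have "{0..} \<union> {..<0} = (UNIV :: int set)" by auto
  ultimately show ?thesis by simp
qed

lemma summable_on_intI:
  fixes f :: "int \<Rightarrow> 'a :: topological_comm_monoid_add"
  assumes "(\<lambda>n. f (int n)) summable_on UNIV" "(\<lambda>n. f (-1 - int n)) summable_on UNIV"
  shows "f summable_on UNIV"
  using assms has_sum_intI unfolding summable_on_def by blast

lemma has_sum_diff:
  fixes f g :: "'a \<Rightarrow> 'b :: topological_ab_group_add"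
  assumes "(f has_sum a) A" "(g has_sum b) A"
  shows "((\<lambda>x. f x - g x) has_sum (a - b)) A"
  using has_sum_add[OF assms(1), of "\<lambda>x. - g x" "- b"] assms(2) by (simp add: has_sum_uminus)

text \<open>This turns an unordered sum over the integers into a limit along intervals, so a value
  known only as such a limit can be identified once summability is established.\<close>

lemma filterlim_int_interval_finite_subsets:
  "filterlim (\<lambda>N. {- int N..<int N}) (finite_subsets_at_top UNIV) sequentially"
  unfolding filterlim_finite_subsets_at_top
proof safe
  fix X :: "int set" assume X: "finite X"
  define K where "K = nat (\<Sum>x\<in>X. \<bar>x\<bar>) + 1"
  have K: "\<bar>x\<bar> < int K" if "x \<in> X" for x
    using member_le_sum[OF that, of "\<lambda>x. \<bar>x\<bar>"] X by (simp add: K_def)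
  show "\<forall>\<^sub>F N in sequentially. finite {- int N..<int N} \<and> X \<subseteq> {- int N..<int N} \<and>
      {- int N..<int N} \<subseteq> UNIV"
    using eventually_ge_at_top[of K]
  proof eventually_elim
    case (elim N)
    then show ?case using K by force
  qed
qed

lemma has_sum_int_imp_LIMSEQ:
  assumes "(f has_sum S) (UNIV :: int set)"
  shows "(\<lambda>N. \<Sum>n\<in>{- int N..<int N}. f n) \<longlonglongrightarrow> S"
  using filterlim_compose[OF assms[unfolded has_sum_def] filterlim_int_interval_finite_subsets] .

text \<open>Summability is a hypothesis, so only the value is at stake. It is read off along the
  intervals, where the partial sums collapse to \<open>f (- int N) - f (int N)\<close>.\<close>

lemma has_sum_int_telescope:
  fixes f :: "int \<Rightarrow> 'a :: {topological_ab_group_add, t2_space}"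
  assumes "(\<lambda>n. f n - f (n + 1)) summable_on UNIV"
    and "(\<lambda>N. f (- int N)) \<longlonglongrightarrow> l" "(\<lambda>N. f (int N)) \<longlonglongrightarrow> u"
  shows "((\<lambda>n. f n - f (n + 1)) has_sum (l - u)) UNIV"
proof -
  obtain S where S: "((\<lambda>n. f n - f (n + 1)) has_sum S) UNIV"
    using assms(1) by (auto simp: summable_on_def)
  have "(\<Sum>n\<in>{- int N..<int N}. f n - f (n + 1)) = f (- int N) - f (int N)" for N
  proof (induction N)
    case (Suc N)
    have "{- int (Suc N)..<int (Suc N)} = insert (- int (Suc N)) (insert (int N) {- int N..<int N})"
      by auto
    then show ?case using Suc by (simp add: algebra_simps)
  qed simp
  then have "(\<lambda>N. f (- int N) - f (int N)) \<longlonglongrightarrow> S"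
    using has_sum_int_imp_LIMSEQ[OF S] by simp
  moreover have "(\<lambda>N. f (- int N) - f (int N)) \<longlonglongrightarrow> l - u"
    by (intro tendsto_diff assms)
  ultimately have "S = l - u" by (rule LIMSEQ_unique)
  then show ?thesis using S by simp
qed

section \<open>Partial fractions of the cotangent\<close>

lemma not_Ints_imp_not_nonpos_Ints:
  fixes z :: "'a :: ring_char_0"
  assumes "z \<notin> \<int>"
  shows "z \<notin> \<int>\<^sub>\<le>\<^sub>0" "1 - z \<notin> \<int>\<^sub>\<le>\<^sub>0"
proof -
  show "z \<notin> \<int>\<^sub>\<le>\<^sub>0" using assms nonpos_Ints_Int by blast
  show "1 - z \<notin> \<int>\<^sub>\<le>\<^sub>0"
  proof
    assume "1 - z \<in> \<int>\<^sub>\<le>\<^sub>0"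
    then have "1 - (1 - z) \<in> \<int>" by (intro Ints_diff Ints_1 nonpos_Ints_Int)
    with assms show False by simp
  qed
qed

lemma sin_pi_mult_nonzero:
  fixes z :: complex
  assumes "z \<notin> \<int>"
  shows "sin (of_real pi * z) \<noteq> 0"
  using not_Ints_imp_not_nonpos_Ints[OF assms]
  by (metis divide_eq_0_iff mult_eq_0_iff rGamma_eq_zero_iff rGamma_reflection_complex)

text \<open>This is the logarithmic derivative of the reflection formula for
  \<open>rGamma\<close>.\<close>

lemma Digamma_reflection:
  fixes z :: complex
  assumes "z \<notin> \<int>"
  shows "Digamma (1 - z) - Digamma z = of_real pi * cot (of_real pi * z)"
proof -
  let ?G = "\<lambda>z :: complex. rGamma z * rGamma (1 - z)"
  note z = not_Ints_imp_not_nonpos_Ints[OF assms]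
  have "(?G has_field_derivative ?G z * (Digamma (1 - z) - Digamma z)) (at z)"
    using z by (auto intro!: derivative_eq_intros simp: algebra_simps)
  moreover have "?G = (\<lambda>z. sin (of_real pi * z) / of_real pi)"
    by (simp add: rGamma_reflection_complex)
  moreover have "((\<lambda>z::complex. sin (of_real pi * z) / of_real pi) has_field_derivative cos (of_real pi * z)) (at z)"
    by (auto intro!: derivative_eq_intros)
  ultimately have "sin (of_real pi * z) / of_real pi * (Digamma (1 - z) - Digamma z) = cos (of_real pi * z)"
    by (metis DERIV_unique)
  moreover have "sin (of_real pi * z) \<noteq> 0"
    using assms by (rule sin_pi_mult_nonzero)
  ultimately show ?thesis by (simp add: cot_def field_simps)
qed

text \<open>In the difference of the two Digamma limits the logarithms cancel. The N terms from
  \<open>z\<close> and the N terms from \<open>1 - z\<close> fill exactly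
  \<open>{- int N..<int N}\<close>. The series is not absolutely convergent, hence a limit along
  intervals instead of \<open>has_sum\<close>.\<close>

lemma cot_partial_fractions:
  fixes z :: complex
  assumes "z \<notin> \<int>"
  shows "(\<lambda>N. \<Sum>n\<in>{- int N..<int N}. inverse (z + of_int n)) \<longlonglongrightarrow> of_real pi * cot (of_real pi * z)"
proof -
  have "z \<noteq> 0" "1 - z \<noteq> 0" using assms by auto
  from tendsto_diff[OF Digamma_LIMSEQ[OF this(2)] Digamma_LIMSEQ[OF this(1)]]
  have *: "(\<lambda>N. (\<Sum>n<N. inverse (z + of_nat n)) - (\<Sum>n<N. inverse (1 - z + of_nat n)))
      \<longlonglongrightarrow> of_real pi * cot (of_real pi * z)"
    unfolding Digamma_reflection[OF assms] by simp
  have "(\<Sum>n<N. inverse (z + of_nat n)) - (\<Sum>n<N. inverse (1 - z + of_nat n)) =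
     (\<Sum>n\<in>{- int N..<int N}. inverse (z + of_int n))" for N
  proof (induction N)
    case (Suc N)
    have 1: "{- int (Suc N)..<int (Suc N)} = insert (- int (Suc N)) (insert (int N) {- int N..<int N})"
      by auto
    have 2: "inverse (z + of_int (- int (Suc N))) = - inverse (1 - z + of_nat N)"
      by (subst inverse_minus_eq [symmetric]) (simp add: algebra_simps)
    have "(\<Sum>n\<in>{- int (Suc N)..<int (Suc N)}. inverse (z + of_int n)) =
       - inverse (1 - z + of_nat N) + (inverse (z + of_nat N) + (\<Sum>n\<in>{- int N..<int N}. inverse (z + of_int n)))"
      unfolding 1 2 [symmetric] by simp
    then show ?case using Suc by simp
  qed simp
  with * show ?thesis by simp
qed

section \<open>Sums of inverse squares over the integers\<close>

text \<open>Differentiate \<open>Digamma_reflection\<close>, which holds on the open complement of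
  the integers.\<close>

lemma Polygamma_1_reflection:
  fixes z :: complex
  assumes "z \<notin> \<int>"
  shows "Polygamma 1 z + Polygamma 1 (1 - z) = (of_real pi / sin (of_real pi * z))^2"
proof -
  have "open (- \<int> :: complex set)"
    by (simp add: closed_Ints open_Compl)
  note z = not_Ints_imp_not_nonpos_Ints[OF assms]
  note s = sin_pi_mult_nonzero[OF assms]
  have "((\<lambda>z. Digamma (1 - z) - Digamma z) has_field_derivative - Polygamma 1 (1 - z) - Polygamma 1 z) (at z)"
    using z by (auto intro!: derivative_eq_intros)
  moreover have "((\<lambda>z. of_real pi * cot (of_real pi * z)) has_field_derivative
      of_real pi * (- inverse (sin (of_real pi * z)^2) * of_real pi)) (at z)"
    using s by (auto intro!: derivative_eq_intros DERIV_cot[THEN DERIV_chain2])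
  then have "((\<lambda>z. Digamma (1 - z) - Digamma z) has_field_derivative
      of_real pi * (- inverse (sin (of_real pi * z)^2) * of_real pi)) (at z)"
    by (rule has_field_derivative_transform_within_open[OF _ \<open>open (- \<int>)\<close>])
       (use assms Digamma_reflection in auto)
  ultimately have "- Polygamma 1 (1 - z) - Polygamma 1 z = of_real pi * (- inverse (sin (of_real pi * z)^2) * of_real pi)"
    by (rule DERIV_unique)
  then have "Polygamma 1 z + Polygamma 1 (1 - z) = - (of_real pi * (- inverse (sin (of_real pi * z)^2) * of_real pi))"
    by (metis add.commute minus_diff_eq diff_minus_eq_add minus_minus)
  then show ?thesis by (simp add: field_simps power2_eq_square)
qed

text \<open>As soon as n is at least 2 |z| + 1, the norm of z + n is at least n / 2, so 4 / n^2
  dominates.\<close>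

lemma summable_norm_inverse_shifted_square:
  fixes z :: complex
  shows "summable (\<lambda>n. norm (inverse ((z + of_nat n)^2)))"
proof (rule summable_comparison_test_ev)
  show "summable (\<lambda>n. 4 * inverse (real n ^ 2))"
    by (intro summable_mult inverse_power_summable) simp
  have "eventually (\<lambda>n. real n \<ge> 2 * norm z + 1) sequentially"
    by (rule eventually_compose_filterlim[OF eventually_ge_at_top filterlim_real_sequentially])
  then show "\<forall>\<^sub>F n in sequentially. norm (norm (inverse ((z + of_nat n)^2))) \<le> 4 * inverse (real n ^ 2)"
  proof eventually_elim
    case (elim n)
    have "real n \<le> norm (z + of_nat n) + norm z"
      using norm_triangle_ineq4[of "z + of_nat n" z] by simp
    then have "real n / 2 \<le> norm (z + of_nat n)" using elim by simp
    then have "(real n / 2)^2 \<le> norm (z + of_nat n)^2" by (intro power_mono) auto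
    moreover have "n > 0" using elim norm_ge_zero[of z] by (cases n) auto
    ultimately have "inverse (norm (z + of_nat n)^2) \<le> inverse ((real n / 2)^2)"
      by (intro le_imp_inverse_le) auto
    then show ?case by (simp add: norm_inverse norm_power norm_divide power_divide field_simps)
  qed
qed

text \<open>The value at \<open>0\<close> is twice \<open>\<zeta>(2)\<close>: since \<open>inverse 0 = 0\<close>, the sums of
  \<open>inverse ((w + n)\<^sup>2)\<close> over all integers \<open>n\<close> omit the origin automatically.\<close>

definition inverse_square_sum :: "complex \<Rightarrow> complex" where
  "inverse_square_sum w = (if w = 0 then of_real (pi^2 / 3) else (of_real pi / sin (of_real pi * w))^2)"

lemma inverse_square_sum_minus: "inverse_square_sum (- w) = inverse_square_sum w"
  by (simp add: inverse_square_sum_def)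

lemma has_sum_inverse_square:
  assumes "w \<notin> \<int> \<or> w = 0"
  shows "((\<lambda>n. inverse ((w + of_int n)^2)) has_sum inverse_square_sum w) UNIV"
proof (cases "w = 0")
  case False
  have P: "((\<lambda>n. inverse ((z + of_nat n)^2)) has_sum Polygamma 1 z) UNIV" if "z \<noteq> 0" for z :: complex
    using summable_norm_inverse_shifted_square Polygamma_LIMSEQ[OF that, of 1]
    by (intro norm_summable_imp_has_sum) (auto simp: eval_nat_numeral)
  have w1: "w \<noteq> 1" using assms False by auto
  have "(-1 - of_nat n + w)^2 = (1 - w + of_nat n)^2" for n
    by (simp add: power2_eq_square algebra_simps)
  then have "((\<lambda>n. inverse ((w + of_int n)^2)) has_sum (Polygamma 1 w + Polygamma 1 (1 - w))) UNIV"
    using P[of w] P[of "1 - w"] assms False w1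
    by (intro has_sum_intI) (auto simp: add_ac)
  then show ?thesis
    using Polygamma_1_reflection[of w] assms False by (simp add: inverse_square_sum_def)
next
  case True
  have *: "((\<lambda>n. 1 / real (n + 1)^2) has_sum (pi^2 / 6)) UNIV"
    using inverse_squares_sums by (intro sums_nonneg_imp_has_sum) (auto simp: add_ac)
  have 1: "((\<lambda>n. inverse (of_nat (n + 1)^2)) has_sum complex_of_real (pi^2 / 6)) UNIV"
    using has_sum_of_real[OF *, where ?'a = complex] by (simp add: inverse_eq_divide)
  \<comment> \<open>The index 0 can be added to the Basel sum at no cost because
    \<open>inverse 0 = 0\<close>.\<close>
  have "((\<lambda>n::nat. inverse (of_nat n ^ 2)) has_sum complex_of_real (pi^2 / 6)) (range Suc)"
    using 1 by (subst has_sum_reindex) (auto simp: o_def)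
  then have "((\<lambda>n::nat. inverse (of_nat n ^ 2)) has_sum complex_of_real (pi^2 / 6)) UNIV"
    using has_sum_insert[of 0 "range Suc" "\<lambda>n::nat. inverse (of_nat n ^ 2) :: complex"]
    by (simp flip: UNIV_nat_eq)
  moreover have "(-1 - of_nat n)^2 = (of_nat (n + 1)^2 :: complex)" for n
    by (simp add: power2_eq_square algebra_simps)
  ultimately have "((\<lambda>n. inverse ((w + of_int n)^2)) has_sum (of_real (pi^2 / 6) + of_real (pi^2 / 6))) UNIV"
    using 1 True by (intro has_sum_intI) auto
  then show ?thesis using True by (simp add: inverse_square_sum_def)
qed

section \<open>Summability over the lattice\<close>

text \<open>The exponent shares cubic decay equally between the two coordinates of a lattice point,
  and 3/2 > 1 still gives summability. The shift by 1 keeps the base positive.\<close>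

definition int_weight :: "int \<Rightarrow> real" where
  "int_weight n = (1 + \<bar>of_int n\<bar>) powr (-3/2)"

lemma summable_on_Times_mult:
  fixes f :: "'a \<Rightarrow> real" and g :: "'b \<Rightarrow> real"
  assumes "f summable_on A" "g summable_on B" "\<And>x. x \<in> A \<Longrightarrow> f x \<ge> 0" "\<And>y. y \<in> B \<Longrightarrow> g y \<ge> 0"
  shows "(\<lambda>(x, y). f x * g y) summable_on A \<times> B"
proof (rule summable_on_SigmaI)
  show "((\<lambda>y. case (x, y) of (x, y) \<Rightarrow> f x * g y) has_sum f x * infsum g B) B" for x
    using assms(2) by (auto intro!: has_sum_cmult_right)
  show "(\<lambda>x. f x * infsum g B) summable_on A"
    using assms(1) by (rule summable_on_cmult_left)
qed (use assms in auto)

lemma int_weight_summable: "int_weight summable_on UNIV"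
proof -
  have "summable (\<lambda>n. of_nat n powr (-3/2) :: real)"
    by (simp add: summable_real_powr_iff)
  then have "summable (\<lambda>n. of_nat (Suc n) powr (-3/2) :: real)"
    by (subst summable_Suc_iff)
  then have *: "(\<lambda>n. of_nat (Suc n) powr (-3/2) :: real) summable_on UNIV"
    by (subst summable_on_UNIV_nonneg_real_iff) auto
  have "inj_on Suc UNIV" by simp
  then have "(\<lambda>n. of_nat n powr (-3/2) :: real) summable_on range Suc"
    using * by (subst summable_on_reindex) (auto simp: o_def)
  \<comment> \<open>The negative integer \<open>-1 - int n\<close> has weight (n + 2) powr (-3/2),
    so a second shift is needed.\<close>
  then have "(\<lambda>n. of_nat n powr (-3/2) :: real) summable_on range (\<lambda>n. Suc (Suc n))"
    by (rule summable_on_subset) auto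
  then have **: "(\<lambda>n. of_nat (Suc (Suc n)) powr (-3/2) :: real) summable_on UNIV"
    by (subst (asm) summable_on_reindex) (auto simp: o_def inj_on_def)
  show ?thesis
    unfolding int_weight_def using * ** by (intro summable_on_intI) (simp_all add: add_ac abs_if)
qed

text \<open>The imaginary part of x z + y controls x, and the triangle inequality then controls
  y.\<close>

lemma cmod_lattice_ge:
  assumes "Im z > 0"
  obtains K where "K > 0" "\<And>x y :: real. \<bar>x\<bar> + \<bar>y\<bar> \<le> K * cmod (of_real x * z + of_real y)"
proof
  let ?K = "1 + (1 + cmod z) / Im z"
  show "?K > 0" using assms by (intro add_pos_nonneg) auto
  fix x y :: real
  let ?w = "of_real x * z + of_real y"
  have "\<bar>x\<bar> * Im z \<le> cmod ?w"
    using abs_Im_le_cmod[of ?w] assms by (simp add: abs_mult)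
  then have x: "\<bar>x\<bar> \<le> cmod ?w / Im z" using assms by (simp add: field_simps)
  have "\<bar>y\<bar> \<le> cmod ?w + \<bar>x\<bar> * cmod z"
    using norm_triangle_ineq4[of ?w "of_real x * z"] by (simp add: norm_mult)
  also have "\<dots> \<le> cmod ?w + cmod ?w / Im z * cmod z"
    using x by (intro add_mono mult_right_mono) auto
  finally show "\<bar>x\<bar> + \<bar>y\<bar> \<le> ?K * cmod ?w" using x by (simp add: algebra_simps add_divide_distrib)
qed

lemma lattice_point_eq_0_iff:
  assumes "Im z > 0"
  shows "of_int m * z + of_int n = 0 \<longleftrightarrow> m = 0 \<and> n = 0"
proof
  assume *: "of_int m * z + of_int n = 0"
  then have "Im (of_int m * z + of_int n) = 0" by simp
  then have "m = 0" using assms by simp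
  with * show "m = 0 \<and> n = 0" by simp
qed simp

text \<open>Apart from the two points where a denominator vanishes, the term equals
  \<open>1 / (w\<^sup>2 (w + 1))\<close> with \<open>w = m z + n\<close>, hence has cubic decay.\<close>

lemma lattice_term_bound:
  assumes "Im z > 0"
  obtains C where "\<And>m n. (m, n) \<notin> {(0, 0), (0, -1)} \<Longrightarrow>
    cmod (inverse ((of_int m * z + of_int n)^2) -
       (inverse (of_int m * z + of_int n) - inverse (of_int m * z + of_int (n + 1))))
      \<le> C * (int_weight m * int_weight n)"
proof -
  obtain K where K: "K > 0" "\<And>x y :: real. \<bar>x\<bar> + \<bar>y\<bar> \<le> K * cmod (of_real x * z + of_real y)"
    using cmod_lattice_ge[OF assms] by blast
  show thesis
  proof
    fix m n :: int assume mn: "(m, n) \<notin> {(0, 0), (0, -1)}"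
    let ?w = "of_int m * z + of_int n" and ?s = "1 + \<bar>real_of_int m\<bar> + \<bar>real_of_int n\<bar>"
    have nz: "?w \<noteq> 0" "?w + 1 \<noteq> 0"
      using mn lattice_point_eq_0_iff[OF assms, of m n] lattice_point_eq_0_iff[OF assms, of m "n + 1"]
      by (auto simp: add_ac)
    have k1: "\<bar>real_of_int m\<bar> + \<bar>real_of_int n\<bar> \<le> K * cmod ?w" using K(2)[of m n] by simp
    have k2: "\<bar>real_of_int m\<bar> + \<bar>real_of_int (n + 1)\<bar> \<le> K * cmod (?w + 1)"
      using K(2)[of m "n + 1"] by (simp add: add_ac)
    \<comment> \<open>Excluding the two points makes both sums at least 1, which absorbs the
      additive constants: 1 + |m| + |n| is at most 2 + |m| + |n + 1|, hence at most 3 (|m| + |n +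
      1|).\<close>
    have "\<bar>m\<bar> + \<bar>n\<bar> \<ge> 1" "\<bar>m\<bar> + \<bar>n + 1\<bar> \<ge> 1" using mn by auto
    then have "\<bar>real_of_int m\<bar> + \<bar>real_of_int n\<bar> \<ge> 1" "\<bar>real_of_int m\<bar> + \<bar>real_of_int (n + 1)\<bar> \<ge> 1"
      by linarith+
    moreover have "\<bar>real_of_int n\<bar> \<le> \<bar>real_of_int (n + 1)\<bar> + 1" by simp
    ultimately have w1: "?s \<le> 3 * K * cmod ?w" and w2: "?s \<le> 3 * K * cmod (?w + 1)"
      using k1 k2 unfolding mult.assoc by linarith+
    have "?s ^ 3 = ?s * ?s * ?s" by (simp add: power3_eq_cube)
    also have "\<dots> \<le> (3 * K * cmod ?w) * (3 * K * cmod ?w) * (3 * K * cmod (?w + 1))"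
      using w1 w2 K(1) by (intro mult_mono) auto
    finally have b: "?s ^ 3 \<le> 27 * K^3 * cmod (?w^2 * (?w + 1))"
      by (simp add: norm_mult norm_power power2_eq_square power3_eq_cube mult_ac)
    \<comment> \<open>Raising this to the power 3/2 separates the cubic bound into a product of
      one-variable weights.\<close>
    have "(1 + \<bar>real_of_int m\<bar>) * (1 + \<bar>real_of_int n\<bar>) \<le> ?s^2"
      by (simp add: power2_eq_square algebra_simps)
    then have "((1 + \<bar>real_of_int m\<bar>) * (1 + \<bar>real_of_int n\<bar>)) powr (3/2) \<le> (?s^2) powr (3/2)"
      by (intro powr_mono2) auto
    also have "(?s^2) powr (3/2) = ?s ^ 3"
      by (simp flip: powr_numeral add: powr_powr)
    finally have "inverse (?s ^ 3) \<le> inverse (((1 + \<bar>real_of_int m\<bar>) * (1 + \<bar>real_of_int n\<bar>)) powr (3/2))"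
      by (intro le_imp_inverse_le) auto
    also have "\<dots> = int_weight m * int_weight n"
      by (simp add: int_weight_def powr_mult powr_minus)
    finally have c: "inverse (?s ^ 3) \<le> int_weight m * int_weight n" .
    have "inverse (?w^2) - (inverse ?w - inverse (?w + 1)) = inverse (?w^2 * (?w + 1))"
      using nz by (simp add: divide_simps power2_eq_square)
    then have "cmod (inverse (?w^2) - (inverse ?w - inverse (of_int m * z + of_int (n + 1)))) = 
       inverse (cmod (?w^2 * (?w + 1)))"
      by (simp add: norm_inverse add_ac norm_mult)
    also have "\<dots> \<le> 27 * K^3 * inverse (?s ^ 3)"
    proof -
      have "inverse y \<le> X * inverse x" if "x \<le> X * y" "x > 0" "y > 0" for x y X :: real
        using that by (simp add: field_simps)
      moreover have "?s ^ 3 > 0" by (intro zero_less_power add_pos_nonneg) auto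
      ultimately show ?thesis using b nz by simp
    qed
    also have "\<dots> \<le> 27 * K^3 * (int_weight m * int_weight n)"
      using c K(1) by (intro mult_left_mono) auto
    finally show "cmod (inverse (?w^2) - (inverse ?w - inverse (of_int m * z + of_int (n + 1))))
      \<le> 27 * K^3 * (int_weight m * int_weight n)" .
  qed
qed

text \<open>The weights dominate off a two-element set, and finitely many terms do not affect
  summability.\<close>

lemma summable_on_lattice:
  assumes "Im z > 0"
  shows "(\<lambda>(m, n). inverse ((of_int m * z + of_int n)^2) -
       (inverse (of_int m * z + of_int n) - inverse (of_int m * z + of_int (n + 1)))) summable_on UNIV \<times> UNIV"
    (is "?F summable_on _")
proof -
  let ?X = "{(0, 0), (0, -1)} :: (int \<times> int) set"
  obtain C where C: "\<And>m n. (m, n) \<notin> ?X \<Longrightarrow> cmod (?F (m, n)) \<le> C * (int_weight m * int_weight n)"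
    using lattice_term_bound[OF assms] by auto
  have "(\<lambda>(m, n). int_weight m * int_weight n) summable_on UNIV \<times> UNIV"
    by (intro summable_on_Times_mult int_weight_summable) (auto simp: int_weight_def)
  then have "(\<lambda>x. C * (case x of (m, n) \<Rightarrow> int_weight m * int_weight n)) summable_on (UNIV - ?X)"
    by (intro summable_on_cmult_right) (auto elim: summable_on_subset)
  then have "(\<lambda>x. norm (?F x)) summable_on (UNIV - ?X)"
    by (rule Infinite_Sum.abs_summable_on_comparison_test') (use C in auto)
  then have "?F summable_on (UNIV - ?X)"
    by (rule abs_summable_summable)
  then have "?F summable_on (UNIV - ?X) \<union> ?X"
    by (intro summable_on_union) auto
  moreover have "(UNIV - ?X) \<union> ?X = UNIV \<times> UNIV" by auto
  ultimately show ?thesis by (simp only:)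
qed

section \<open>The Lambert series of the Eisenstein series\<close>

lemma norm_q_of_less_1: "Im z > 0 \<Longrightarrow> norm (q_of z) < 1"
  by (simp add: q_of_def)

lemma q_of_of_nat_mult: "q_of (of_nat n * z) = q_of z ^ n"
  by (simp add: q_of_def exp_of_nat_mult [symmetric] mult_ac)

lemma complex_not_Ints: "Im w \<noteq> 0 \<Longrightarrow> w \<notin> \<int>"
  by (auto elim: Ints_cases)

text \<open>In terms of q = \<open>q_of w\<close>, pi^2 / sin^2(pi w) equals -4 pi^2 q / (1 - q)^2,
  which the differentiated geometric series expands.\<close>

lemma inverse_square_sum_sums:
  assumes "Im w > 0"
  shows "(\<lambda>k. -4 * of_real pi^2 * (of_nat (Suc k) * q_of w ^ Suc k)) sums inverse_square_sum w"
proof -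
  let ?e = "exp (\<i> * (of_real pi * w))"
  have q: "norm (q_of w) < 1" using norm_q_of_less_1[OF assms] .
  have qe: "q_of w = ?e^2"
    by (simp add: q_of_def flip: exp_double) (simp add: mult_ac)
  have "sin (of_real pi * w) = (?e - inverse ?e) / (2 * \<i>)"
    by (simp add: sin_exp_eq exp_minus)
  then have "sin (of_real pi * w) = - (1 - q_of w) / (2 * \<i> * ?e)"
    by (simp add: qe field_simps power2_eq_square)
  then have "(of_real pi / sin (of_real pi * w))^2 = (of_real pi)^2 * (2 * \<i> * ?e)^2 / (1 - q_of w)^2"
    by (simp add: power_divide power_mult_distrib power2_commute)
  also have "(2 * \<i> * ?e)^2 = -4 * q_of w"
    by (simp add: power_mult_distrib qe)
  finally have "inverse_square_sum w = -4 * of_real pi^2 * (q_of w * (1 / (1 - q_of w)^2))"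
    using assms by (auto simp: inverse_square_sum_def)
  moreover have "(\<lambda>k. -4 * of_real pi^2 * (q_of w * (of_nat (Suc k) * q_of w ^ k))) sums
      (-4 * of_real pi^2 * (q_of w * (1 / (1 - q_of w)^2)))"
    by (intro sums_mult geometric_deriv_sums q)
  ultimately show ?thesis by (simp add: mult_ac)
qed

text \<open>Since (m + 1)(k + 1) is at least m + k, the terms are dominated by a product of two
  convergent one-variable series.\<close>

lemma summable_on_Lambert:
  fixes q :: complex
  assumes "norm q < 1"
  shows "(\<lambda>(m, k). of_nat (Suc k) * q ^ (Suc m * Suc k)) summable_on UNIV \<times> UNIV"
proof -
  define r where "r = norm q"
  have r: "0 \<le> r" "r < 1" using assms by (auto simp: r_def)
  have "(\<lambda>m. r ^ m) summable_on UNIV"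
    using r by (intro summable_nonneg_imp_summable_on summable_geometric) auto
  moreover have "(\<lambda>k. real (Suc k) * r ^ k) summable_on UNIV"
    using r sums_summable[OF geometric_deriv_sums[of r]]
    by (intro summable_nonneg_imp_summable_on) auto
  ultimately have "(\<lambda>(m, k). r ^ m * (real (Suc k) * r ^ k)) summable_on UNIV \<times> UNIV"
    using r by (intro summable_on_Times_mult) auto
  then have "(\<lambda>x. norm (case x of (m, k) \<Rightarrow> of_nat (Suc k) * q ^ (Suc m * Suc k))) summable_on UNIV \<times> UNIV"
  proof (rule Infinite_Sum.abs_summable_on_comparison_test')
    fix x :: "nat \<times> nat"
    obtain m k where x: "x = (m, k)" by (cases x)
    have "r ^ (Suc m * Suc k) \<le> r ^ (m + k)"
      using r by (intro power_decreasing) auto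
    then have "real (Suc k) * r ^ (Suc m * Suc k) \<le> real (Suc k) * r ^ (m + k)"
      by (intro mult_left_mono) auto
    then show "norm (case x of (m, k) \<Rightarrow> of_nat (Suc k) * q ^ (Suc m * Suc k)) \<le>
        (case x of (m, k) \<Rightarrow> r ^ m * (real (Suc k) * r ^ k))"
      unfolding x prod.case norm_mult norm_power norm_of_nat r_def [symmetric]
      by (simp only: power_add mult_ac)
  qed
  then show ?thesis by (rule abs_summable_summable)
qed

text \<open>Group the pairs by the product n + 1 = (m + 1)(k + 1). The factor d = k + 1 then runs
  through the divisors of n + 1, and the coefficients add up to \<open>divisor_sum\<close>.\<close>

lemma has_sum_Lambert:
  fixes q :: complex
  assumes "norm q < 1"
  shows "((\<lambda>(m, k). of_nat (Suc k) * q ^ (Suc m * Suc k)) has_sum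
     (\<Sum>n. of_nat (divisor_sum (Suc n)) * q ^ Suc n)) UNIV"
proof -
  let ?F = "\<lambda>(m, k). of_nat (Suc k) * q ^ (Suc m * Suc k)"
  let ?G = "\<lambda>(n, d). of_nat d * q ^ Suc n"
  obtain S where S: "(?F has_sum S) UNIV"
    using summable_on_Lambert[OF assms] by (auto simp: summable_on_def)
  also have "(?F has_sum S) UNIV \<longleftrightarrow> (?G has_sum S) (Sigma UNIV (\<lambda>n. {d. d dvd Suc n}))"
  proof (rule has_sum_reindex_bij_witness[where
        i = "\<lambda>(n, d). (Suc n div d - 1, d - 1)" and j = "\<lambda>(m, k). (Suc m * Suc k - 1, Suc k)"])
    fix b assume "b \<in> Sigma UNIV (\<lambda>n. {d. d dvd Suc n})"
    then obtain n d where b: "b = (n, d)" "d dvd Suc n" by auto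
    have "d > 0" using b(2) by (auto intro: Nat.gr0I)
    moreover have "Suc n div d > 0" using b(2) \<open>d > 0\<close> by (simp add: div_greater_zero_iff dvd_imp_le)
    ultimately have "Suc (Suc n div d - 1) = Suc n div d" "Suc (d - 1) = d" by simp_all
    then show "(case case b of (n, d) \<Rightarrow> (Suc n div d - 1, d - 1) of (m, k) \<Rightarrow> (Suc m * Suc k - 1, Suc k)) = b"
      using b by (simp only: prod.case dvd_div_mult_self diff_Suc_1)
  next
    fix a :: "nat \<times> nat"
    obtain m k where a: "a = (m, k)" by (cases a)
    have *: "Suc (Suc m * Suc k - 1) = Suc m * Suc k" by simp
    show "(case case a of (m, k) \<Rightarrow> (Suc m * Suc k - 1, Suc k) of (n, d) \<Rightarrow> (Suc n div d - 1, d - 1)) = a"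
      unfolding a prod.case * by (simp del: mult_Suc mult_Suc_right)
    show "(case a of (m, k) \<Rightarrow> (Suc m * Suc k - 1, Suc k)) \<in> Sigma UNIV (\<lambda>n. {d. d dvd Suc n})"
      unfolding a prod.case mem_Sigma_iff mem_Collect_eq * by (simp del: mult_Suc mult_Suc_right)
    show "(case case a of (m, k) \<Rightarrow> (Suc m * Suc k - 1, Suc k) of (n, d) \<Rightarrow> of_nat d * q ^ Suc n) =
       (case a of (m, k) \<Rightarrow> of_nat (Suc k) * q ^ (Suc m * Suc k))"
      unfolding a prod.case * ..
  qed auto
  finally have "(?G has_sum S) (Sigma UNIV (\<lambda>n. {d. d dvd Suc n}))" .
  then have "((\<lambda>n. of_nat (divisor_sum (Suc n)) * q ^ Suc n) has_sum S) UNIV"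
  proof (rule has_sum_SigmaD)
    fix n
    show "((\<lambda>d. ?G (n, d)) has_sum of_nat (divisor_sum (Suc n)) * q ^ Suc n) {d. d dvd Suc n}"
      by (rule has_sum_finiteI) (auto simp: divisor_sum_def sum_distrib_right)
  qed
  then have "S = (\<Sum>n. of_nat (divisor_sum (Suc n)) * q ^ Suc n)"
    by (intro sums_unique has_sum_imp_sums)
  with S show ?thesis by simp
qed

text \<open>The term m = 0 gives pi^2 / 3. The positive m give -4 pi^2 times the Lambert series, and
  by evenness so do the negative m; the total -8 pi^2 is -24 times pi^2 / 3.\<close>

lemma has_sum_E2:
  assumes "Im z > 0"
  shows "((\<lambda>m. inverse_square_sum (of_int m * z)) has_sum (of_real pi^2 / 3 * E2 z)) UNIV"
proof -
  let ?S = "\<Sum>n. of_nat (divisor_sum (Suc n)) * q_of z ^ Suc n"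
  let ?c = "-4 * of_real pi^2 :: complex"
  have q: "norm (q_of z) < 1" using norm_q_of_less_1[OF assms] .
  have F: "((\<lambda>(m, k). ?c * (of_nat (Suc k) * q_of z ^ (Suc m * Suc k))) has_sum (?c * ?S)) (UNIV \<times> UNIV)"
    using has_sum_cmult_right[OF has_sum_Lambert[OF q], of ?c] by (simp add: case_prod_unfold)
  have P: "((\<lambda>m. inverse_square_sum (of_nat (Suc m) * z)) has_sum (?c * ?S)) UNIV"
  proof (rule has_sum_SigmaD[OF F])
    fix m :: nat
    have "(\<lambda>k. ?c * (of_nat (Suc k) * q_of z ^ (Suc m * Suc k))) summable_on UNIV"
      using summable_on_SigmaD1[of "\<lambda>m k. ?c * (of_nat (Suc k) * q_of z ^ (Suc m * Suc k))" UNIV "\<lambda>_. UNIV" m] F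
      by (auto simp: summable_on_def)
    then obtain s where s: "((\<lambda>k. ?c * (of_nat (Suc k) * q_of z ^ (Suc m * Suc k))) has_sum s) UNIV"
      by (auto simp: summable_on_def)
    have "Im (of_nat (Suc m) * z) > 0" using assms by (simp add: add_pos_nonneg)
    from inverse_square_sum_sums[OF this]
    have "(\<lambda>k. ?c * (of_nat (Suc k) * q_of z ^ (Suc m * Suc k))) sums inverse_square_sum (of_nat (Suc m) * z)"
      by (simp only: q_of_of_nat_mult power_mult)
    with has_sum_imp_sums[OF s] have "s = inverse_square_sum (of_nat (Suc m) * z)"
      by (rule sums_unique2)
    with s show "((\<lambda>k. case (m, k) of (m, k) \<Rightarrow> ?c * (of_nat (Suc k) * q_of z ^ (Suc m * Suc k))) has_sum
        inverse_square_sum (of_nat (Suc m) * z)) UNIV" by simp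
  qed
  have "inj_on Suc UNIV" by simp
  then have "((\<lambda>m. inverse_square_sum (of_nat m * z)) has_sum (?c * ?S)) (range Suc)"
    using P by (subst has_sum_reindex) (auto simp: o_def)
  then have "((\<lambda>m. inverse_square_sum (of_nat m * z)) has_sum
      (inverse_square_sum (of_nat 0 * z) + ?c * ?S)) (insert 0 (range Suc))"
    by (intro has_sum_insert) auto
  moreover have "insert 0 (range Suc) = UNIV" by (rule UNIV_nat_eq [symmetric])
  moreover have "inverse_square_sum (of_int (-1 - int m) * z) = inverse_square_sum (of_nat (Suc m) * z)" for m
    by (subst inverse_square_sum_minus [symmetric]) (simp add: algebra_simps)
  ultimately have "((\<lambda>m. inverse_square_sum (of_int m * z)) has_sum
      (inverse_square_sum (of_nat 0 * z) + ?c * ?S + ?c * ?S)) UNIV"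
    using P by (intro has_sum_intI) auto
  moreover have "inverse_square_sum (of_nat 0 * z) + ?c * ?S + ?c * ?S = of_real pi^2 / 3 * E2 z"
    by (simp add: inverse_square_sum_def E2_def algebra_simps)
  ultimately show ?thesis by (simp only:)
qed

section \<open>Quasi-modularity\<close>

lemma cot_conv_exp:
  assumes "exp (2 * \<i> * w) \<noteq> 1"
  shows "cot w = \<i> * (exp (2 * \<i> * w) + 1) / (exp (2 * \<i> * w) - 1)"
proof -
  let ?e = "exp (\<i> * w)"
  have e: "exp (2 * \<i> * w) = ?e * ?e"
    by (metis exp_double mult.assoc power2_eq_square)
  have "cot w = ((?e + inverse ?e) / 2) / ((?e - inverse ?e) / (2 * \<i>))"
    by (simp add: cot_def sin_exp_eq cos_exp_eq exp_minus)
  also have "\<dots> = \<i> * (?e * ?e + 1) / (?e * ?e - 1)"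
    using assms unfolding e by (simp add: divide_simps)
  finally show ?thesis by (simp only: e)
qed

lemma cot_tendsto_upper:
  assumes "Im v > 0"
  shows "(\<lambda>N. cot (of_real pi * (of_nat N * v))) \<longlonglongrightarrow> - \<i>"
proof -
  have q: "norm (q_of v) < 1" using norm_q_of_less_1[OF assms] .
  have "(\<lambda>N. \<i> * (q_of v ^ N + 1) / (q_of v ^ N - 1)) \<longlonglongrightarrow> \<i> * (0 + 1) / (0 - 1)"
    by (intro tendsto_intros LIMSEQ_power_zero q) auto
  moreover have "\<forall>\<^sub>F N in sequentially.
      \<i> * (q_of v ^ N + 1) / (q_of v ^ N - 1) = cot (of_real pi * (of_nat N * v))"
    \<comment> \<open>N = 0 must be avoided: there \<open>q_of v ^ N = 1\<close> and the exponential
      formula for the cotangent breaks down.\<close>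
    using eventually_gt_at_top[of 0]
  proof eventually_elim
    case (elim N)
    have "norm (q_of v ^ N) < 1" using q elim by (simp add: norm_power power_less_one_iff)
    then have "q_of v ^ N \<noteq> 1" by auto
    moreover have "exp (2 * \<i> * (of_real pi * (of_nat N * v))) = q_of v ^ N"
      by (subst q_of_of_nat_mult [symmetric]) (simp add: q_of_def mult_ac)
    ultimately show ?case by (subst cot_conv_exp) auto
  qed
  ultimately show ?thesis using Lim_transform_eventually by fastforce
qed

section \<open>Row and column sums of the corrected double series\<close>

text \<open>The correction telescopes between ends where 1 / (m z + n) tends to 0. For m = 0 this
  survives the value \<open>inverse 0 = 0\<close>, since telescoping does not depend on individual
  values.\<close>

lemma has_sum_lattice_row:
  assumes "Im z > 0"
  shows "((\<lambda>n. inverse ((of_int m * z + of_int n)^2) -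
       (inverse (of_int m * z + of_int n) - inverse (of_int m * z + of_int (n + 1))))
     has_sum inverse_square_sum (of_int m * z)) UNIV"
    (is "(?F has_sum _) _")
proof -
  let ?f = "\<lambda>n. inverse (of_int m * z + of_int n)"
  have A: "((\<lambda>n. inverse ((of_int m * z + of_int n)^2)) has_sum inverse_square_sum (of_int m * z)) UNIV"
    using assms complex_not_Ints[of "of_int m * z"] by (intro has_sum_inverse_square) auto
  have "?F summable_on UNIV"
    using summable_on_lattice[OF assms] by (rule summable_on_SigmaD1) auto
  then obtain S where S: "(?F has_sum S) UNIV" by (auto simp: summable_on_def)
  have "((\<lambda>n. ?f n - ?f (n + 1)) has_sum 0 - 0) UNIV"
  proof (rule has_sum_int_telescope)
    show "(\<lambda>n. ?f n - ?f (n + 1)) summable_on UNIV"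
      using has_sum_diff[OF A S] by (auto simp: summable_on_def)
    have nat: "filterlim (\<lambda>N. of_nat N :: complex) at_infinity sequentially"
      by (rule tendsto_of_nat)
    show "(\<lambda>N. ?f (int N)) \<longlonglongrightarrow> 0"
      by (rule filterlim_compose[OF tendsto_inverse_0])
         (auto intro!: tendsto_add_filterlim_at_infinity nat)
    have "filterlim (\<lambda>N. - of_nat N :: complex) at_infinity sequentially"
      using nat by (simp add: filterlim_at_infinity_conv_norm_at_top)
    then show "(\<lambda>N. ?f (- int N)) \<longlonglongrightarrow> 0"
      by (intro filterlim_compose[OF tendsto_inverse_0])
         (auto intro!: tendsto_add_filterlim_at_infinity simp del: add_uminus_conv_diff)
  qed
  from has_sum_diff[OF A this] show ?thesis by simp
qed

text \<open>Factoring out z turns a column into a sum over integer shifts of n / z. The two halves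
  of the correction are evaluated separately along intervals, each giving a cotangent; their
  difference is summable, so the interval limit is its sum.\<close>

lemma has_sum_lattice_column:
  assumes "Im z > 0"
  defines "C \<equiv> \<lambda>n :: int. of_real pi / z * cot (of_real pi * (of_int n / z))"
  shows "((\<lambda>m. inverse ((of_int m * z + of_int n)^2) -
       (inverse (of_int m * z + of_int n) - inverse (of_int m * z + of_int (n + 1))))
     has_sum (inverse_square_sum (of_int n / z) / z^2 - (C n - C (n + 1)))) UNIV"
    (is "(?F has_sum _) _")
proof -
  have z: "z \<noteq> 0" using assms by auto
  have scale: "of_int m * z + of_int n = z * (of_int n / z + of_int m)" for m n :: int
    using z by (simp add: field_simps)
  have Z: "of_int n / z \<notin> \<int> \<or> of_int n / z = 0" for n :: int
    using assms(1) complex_not_Ints[of "of_int n / z"] by (auto simp: Im_divide sum_power2_eq_zero_iff)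
  have A: "((\<lambda>m. inverse ((of_int m * z + of_int n)^2)) has_sum (inverse_square_sum (of_int n / z) / z^2)) UNIV"
    unfolding scale power_mult_distrib inverse_mult_distrib
    using has_sum_cmult_right[OF has_sum_inverse_square[OF Z[of n]], of "inverse (z^2)"]
    by (simp add: divide_inverse mult_ac)
  have "(\<lambda>(n, m). inverse ((of_int m * z + of_int n)^2) -
       (inverse (of_int m * z + of_int n) - inverse (of_int m * z + of_int (n + 1)))) summable_on UNIV \<times> UNIV"
    using summable_on_lattice[OF assms(1)] by (subst summable_on_swap) (simp add: case_prod_unfold)
  then have "?F summable_on UNIV"
    by (rule summable_on_SigmaD1) auto
  then obtain S where S: "(?F has_sum S) UNIV" by (auto simp: summable_on_def)
  have lim: "(\<lambda>N. \<Sum>m\<in>{- int N..<int N}. inverse (of_int m * z + of_int n)) \<longlonglongrightarrow> C n" for n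
  proof (cases "n = 0")
    case False
    then have "of_int n / z \<notin> \<int>" using Z[of n] z by auto
    from tendsto_mult_left[OF cot_partial_fractions[OF this], of "inverse z"]
    show ?thesis
      unfolding scale inverse_mult_distrib C_def by (simp add: sum_distrib_left divide_inverse mult_ac)
  next
    case True
    \<comment> \<open>For n = 0 the terms m and -m cancel, m = 0 contributes
      \<open>inverse 0 = 0\<close>, and only m = -N is left. The limit 0 agrees with
      \<open>C 0\<close>, because \<open>cot 0 = 0\<close> by division by zero.\<close>
    have "(\<Sum>m\<in>{- int N..<int N}. inverse (of_int m * z + of_int n)) = - (inverse z * inverse (of_nat N))" for N
    proof (induction N)
      case (Suc N)
      have 1: "{- int (Suc N)..<int (Suc N)} = insert (- int (Suc N)) (insert (int N) {- int N..<int N})"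
        by auto
      have 2: "inverse (of_int (- int (Suc N))) * inverse z = - (inverse z * inverse (of_nat (Suc N)))"
        by (simp only: of_int_minus of_int_of_nat_eq mult_minus_left mult_minus_right inverse_minus_eq inverse_mult_distrib mult.commute)
      show ?case using Suc True unfolding 1 by (simp add: 2 del: of_nat_Suc of_int_minus)
    qed (use True in simp)
    moreover have "(\<lambda>N. - (inverse z * inverse (of_nat N))) \<longlonglongrightarrow> - (inverse z * 0)"
      by (intro tendsto_intros lim_inverse_n)
    ultimately show ?thesis by (simp add: C_def True cot_def)
  qed
  let ?D = "\<lambda>m. inverse (of_int m * z + of_int n) - inverse (of_int m * z + of_int (n + 1))"
  have D: "(?D has_sum (inverse_square_sum (of_int n / z) / z^2 - S)) UNIV"
    using has_sum_diff[OF A S] by simp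
  have "(\<lambda>N. \<Sum>m\<in>{- int N..<int N}. ?D m) \<longlonglongrightarrow> C n - C (n + 1)"
    unfolding sum_subtractf by (intro tendsto_diff lim)
  with has_sum_int_imp_LIMSEQ[OF D] have "inverse_square_sum (of_int n / z) / z^2 - S = C n - C (n + 1)"
    by (rule LIMSEQ_unique)
  with has_sum_diff[OF A D] show ?thesis by simp
qed

theorem E2_inversion:
  assumes "Im z > 0"
  shows "E2 (- 1 / z) = z^2 * E2 z - 6 * \<i> / of_real pi * z"
proof -
  define C where "C = (\<lambda>n :: int. of_real pi / z * cot (of_real pi * (of_int n / z)))"
  let ?F = "\<lambda>(m, n). inverse ((of_int m * z + of_int n)^2) -
       (inverse (of_int m * z + of_int n) - inverse (of_int m * z + of_int (n + 1)))"
  define v where "v = - 1 / z"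
  have z: "z \<noteq> 0" using assms by auto
  have v: "Im v > 0" using assms by (auto simp: v_def Im_divide sum_power2_gt_zero_iff)
  obtain S where S: "(?F has_sum S) (UNIV \<times> UNIV)"
    using summable_on_lattice[OF assms] by (auto simp: summable_on_def)
  have "((\<lambda>m. inverse_square_sum (of_int m * z)) has_sum S) UNIV"
    by (rule has_sum_SigmaD[OF S]) (use has_sum_lattice_row[OF assms] in simp)
  then have S1: "S = of_real pi^2 / 3 * E2 z"
    using has_sum_E2[OF assms] by (rule has_sum_unique)
  have S': "((\<lambda>(n, m). ?F (m, n)) has_sum S) (UNIV \<times> UNIV)"
    using S by (subst (asm) has_sum_swap) (simp add: case_prod_unfold)
  have cols: "((\<lambda>n. inverse_square_sum (of_int n / z) / z^2 - (C n - C (n + 1))) has_sum S) UNIV"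
    by (rule has_sum_SigmaD[OF S']) (use has_sum_lattice_column[OF assms] in \<open>simp add: C_def\<close>)
  \<comment> \<open>Since n / z = - n v, evenness makes this the row expansion of \<open>E2\<close>
    at \<open>v\<close>.\<close>
  have "((\<lambda>n. inverse_square_sum (of_int n / z)) has_sum (of_real pi^2 / 3 * E2 v)) UNIV"
    using has_sum_E2[OF v] inverse_square_sum_minus[of "of_int _ / z"] by (simp add: v_def)
  from has_sum_cmult_right[OF this, of "inverse (z^2)"]
  have A: "((\<lambda>n. inverse_square_sum (of_int n / z) / z^2) has_sum (of_real pi^2 / 3 * E2 v / z^2)) UNIV"
    unfolding divide_inverse [of _ "z^2"] by (simp only: mult.commute)
  \<comment> \<open>At n = -N the cotangent argument is pi N v, going up the half plane with limit
    \<open>- \<i>\<close>; at n = N oddness gives \<open>\<i>\<close>. The total is -2 pi i / z, the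
    source of the non-modular term.\<close>
  have "((\<lambda>n. C n - C (n + 1)) has_sum (of_real pi / z * (- \<i>) - of_real pi / z * \<i>)) UNIV"
  proof (rule has_sum_int_telescope)
    show "(\<lambda>n. C n - C (n + 1)) summable_on UNIV"
      using has_sum_diff[OF A cols] by (auto simp: summable_on_def)
    have "C (- int N) = of_real pi / z * cot (of_real pi * (of_nat N * v))" for N
      by (simp add: C_def v_def)
    then show "(\<lambda>N. C (- int N)) \<longlonglongrightarrow> of_real pi / z * (- \<i>)"
      using tendsto_mult_left[OF cot_tendsto_upper[OF v], of "of_real pi / z"] by (simp only:)
    have "C (int N) = of_real pi / z * - cot (of_real pi * (of_nat N * v))" for N
      by (simp add: C_def v_def cot_def)
    then show "(\<lambda>N. C (int N)) \<longlonglongrightarrow> of_real pi / z * \<i>"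
      using tendsto_mult_left[OF tendsto_minus[OF cot_tendsto_upper[OF v]], of "of_real pi / z"]
      by (simp only: minus_minus)
  qed
  from has_sum_unique[OF cols has_sum_diff[OF A this]] have "S = of_real pi^2 / 3 * E2 v / z^2 - (of_real pi / z * (- \<i>) - of_real pi / z * \<i>)"
    by simp
  moreover have "B = z^2 * A - 2 * p * \<i> * z"
    if "A = B / z^2 - (p / z * (- \<i>) - p / z * \<i>)" for A B p :: complex
  proof -
    have "z^2 * A = z^2 * (B / z^2) + 2 * (z^2 * (p / z)) * \<i>"
      unfolding that by (simp add: algebra_simps)
    also have "z^2 * (p / z) = p * z"
      using z by (simp add: power2_eq_square)
    finally show ?thesis using z by simp
  qed
  ultimately have "of_real pi^2 / 3 * E2 v = z^2 * S - 2 * of_real pi * \<i> * z"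
    by blast
  \<comment> \<open>Dividing 2 pi i z by pi^2 / 3 produces the constant 6 i / pi.\<close>
  moreover have "x = z^2 * y - 6 * \<i> / p * z"
    if "p^2 / 3 * x = z^2 * (p^2 / 3 * y) - 2 * p * \<i> * z" "p \<noteq> 0" for p x y :: complex
  proof -
    have "p^2 / 3 * x = p^2 / 3 * (z^2 * y - 6 * \<i> / p * z)"
      unfolding that(1) using that(2) by (simp add: right_diff_distrib power2_eq_square)
    then show ?thesis using that(2) by simp
  qed
  ultimately have "E2 v = z^2 * E2 z - 6 * \<i> / of_real pi * z"
    unfolding S1 by simp
  then show ?thesis by (simp only: v_def)
qed

section \<open>Translations and lower triangular matrices\<close>

lemma E2_add_of_int: "E2 (z + of_int k) = E2 z"
proof -
  have "q_of (z + of_int k) = q_of z * exp (2 * of_int k * of_real pi * \<i>)"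
    by (simp add: q_of_def ring_distribs exp_add mult_ac)
  also have "exp (2 * of_int k * of_real pi * \<i>) = 1"
    using exp_integer_2pi[of "of_int k"] by simp
  finally have "q_of (z + of_int k) = q_of z" by simp
  then show ?thesis by (simp add: E2_def)
qed

text \<open>The map factors as an inversion, the translation by -c and another inversion: z / (c z +
  1) = -1 / v with v = -1 / z - c.\<close>

lemma E2_lower_triangular:
  assumes "Im z > 0"
  shows "E2 (z / (of_nat c * z + 1)) =
    (of_nat c * z + 1)^2 * E2 z - 6 * \<i> / of_real pi * of_nat c * (of_nat c * z + 1)"
proof -
  define v where "v = - 1 / z + of_int (- int c)"
  have z: "z \<noteq> 0" using assms by auto
  have v: "Im v > 0" using assms by (auto simp: v_def Im_divide sum_power2_gt_zero_iff)
  have vz: "v * z = - (of_nat c * z + 1)" using z by (simp add: v_def field_simps)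
  have "v \<noteq> 0" using v by auto
  have "of_nat c * z + 1 \<noteq> 0" using vz z \<open>v \<noteq> 0\<close> by (metis mult_eq_0_iff neg_0_equal_iff_equal)
  then have "z / (of_nat c * z + 1) = - 1 / v"
    using vz \<open>v \<noteq> 0\<close> by (simp add: field_simps)
  then have "E2 (z / (of_nat c * z + 1)) = v^2 * E2 v - 6 * \<i> / of_real pi * v"
    using E2_inversion[OF v] by simp
  also have "E2 v = z^2 * E2 z - 6 * \<i> / of_real pi * z"
    unfolding v_def E2_add_of_int by (rule E2_inversion[OF assms])
  also have "v^2 * (z^2 * E2 z - 6 * \<i> / of_real pi * z) - 6 * \<i> / of_real pi * v =
      (v * z)^2 * E2 z - 6 * \<i> / of_real pi * (v * (v * z + 1))"
    by (simp add: algebra_simps power2_eq_square add_divide_distrib)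
  \<comment> \<open>The two non-modular terms have merged into a multiple of v (v z + 1), which
    reduces to c (c z + 1).\<close>
  also have "v * z + 1 = - (of_nat c * z)"
    unfolding vz by simp
  also have "v * - (of_nat c * z) = - of_nat c * (v * z)"
    by (simp add: mult_ac)
  also have "- of_nat c * (v * z) = of_nat c * (of_nat c * z + 1)"
    unfolding vz by (simp add: algebra_simps)
  finally show ?thesis unfolding vz power2_minus by (simp add: mult_ac)
qed

text \<open>With u = (c z + 1) / d, the argument c d z / (c z + 1) equals d - 1 / u, so periodicity
  and inversion at u apply. Both summands of \<open>L\<close> then carry the same term (6 i / pi) c
  d u, which cancels.\<close>

lemma L_lower_triangular:
  assumes "Im z > 0" and "d > 0"
  shows "L (c * d) (z / (of_nat c * z + 1)) =
    (of_nat c * z + 1)^2 * (E2 z - of_nat c / of_nat d * E2 ((of_nat c * z + 1) / of_nat d))"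
\<comment> \<open>For c = 0 the point u would be real, outside the domain of the inversion formula;
  there both sides are just \<open>E2 z\<close>.\<close>
proof (cases "c = 0")
  case True
  then show ?thesis by (simp add: L_def)
next
  case False
  define u where "u = (of_nat c * z + 1) / of_nat d"
  have u: "Im u > 0" using assms False by (simp add: u_def)
  then have "u \<noteq> 0" by auto
  have ud: "of_nat c * z + 1 = of_nat d * u" using assms by (simp add: u_def)
  have "of_nat (c * d) * (z / (of_nat c * z + 1)) = - 1 / u + of_int (int d)"
  proof -
    have "of_nat c * z = of_nat d * u - 1" using ud by (simp add: algebra_simps)
    moreover have "of_nat (c * d) * (z / (of_nat c * z + 1)) = of_nat d * (of_nat c * z) / (of_nat c * z + 1)"
      by simp
    ultimately have "of_nat (c * d) * (z / (of_nat c * z + 1)) = of_nat d * (of_nat d * u - 1) / (of_nat d * u)"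
      by (simp only: diff_add_cancel)
    also have "\<dots> = - 1 / u + of_int (int d)"
      using \<open>u \<noteq> 0\<close> assms(2) by (simp add: field_simps)
    finally show ?thesis .
  qed
  then have "E2 (of_nat (c * d) * (z / (of_nat c * z + 1))) = u^2 * E2 u - 6 * \<i> / of_real pi * u"
    by (simp only: E2_add_of_int E2_inversion[OF u])
  then have "L (c * d) (z / (of_nat c * z + 1)) =
      (of_nat d * u)^2 * E2 z - 6 * \<i> / of_real pi * of_nat c * (of_nat d * u)
      - of_nat (c * d) * (u^2 * E2 u - 6 * \<i> / of_real pi * u)"
    by (simp only: L_def E2_lower_triangular[OF assms(1)] flip: ud)
  also have "\<dots> = (of_nat d * u)^2 * (E2 z - of_nat c / of_nat d * E2 u)"
    using assms(2) by (simp add: field_simps power2_eq_square)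
  finally show ?thesis by (simp only: ud [symmetric] u_def [symmetric])
qed

theorem theorem3p1:
  shows "(\<forall>t::nat. t > 1 \<longrightarrow>
            (\<forall>z\<in>upper_half_plane.
               L t (moebius_act (matrix_inv (A_mat 1)) z) =
                 (z + 1)^2 * (E2 z - 1 / of_nat t * E2 ((z + 1) / of_nat t)))) \<and>
         (\<forall>p1 p2::nat. prime p1 \<longrightarrow> prime p2 \<longrightarrow>
            (\<forall>z\<in>upper_half_plane.
               L (p1 * p2) (moebius_act (matrix_inv (A_mat (int p1))) z) =
                 (of_nat p1 * z + 1)^2 *
                   (E2 z - of_nat p1 / of_nat p2 * E2 ((of_nat p1 * z + 1) / of_nat p2))) \<and>
            (\<forall>z\<in>upper_half_plane.
               L (p1 * p2) (moebius_act (matrix_inv (A_mat (int p2))) z) =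
                 (of_nat p2 * z + 1)^2 *
                   (E2 z - of_nat p2 / of_nat p1 * E2 ((of_nat p2 * z + 1) / of_nat p1))))"
proof (intro conjI allI impI ballI)
  \<comment> \<open>The three identities are the cases (c, d) = (1, t), (p1, p2) and (p2, p1) of
    \<open>L_lower_triangular\<close>.\<close>
  fix t :: nat and z assume "t > 1" "z \<in> upper_half_plane"
  then show "L t (moebius_act (matrix_inv (A_mat 1)) z) =
      (z + 1)^2 * (E2 z - 1 / of_nat t * E2 ((z + 1) / of_nat t))"
    using L_lower_triangular[of z t 1] by (simp add: moebius_act_matrix_inv_A_mat upper_half_plane_def)
next
  fix p1 p2 :: nat and z assume "prime p1" "prime p2" "z \<in> upper_half_plane"
  then show "L (p1 * p2) (moebius_act (matrix_inv (A_mat (int p1))) z) =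
      (of_nat p1 * z + 1)^2 * (E2 z - of_nat p1 / of_nat p2 * E2 ((of_nat p1 * z + 1) / of_nat p2))"
    using L_lower_triangular[of z p2 p1] prime_gt_0_nat
    by (simp add: moebius_act_matrix_inv_A_mat upper_half_plane_def)
next
  fix p1 p2 :: nat and z assume "prime p1" "prime p2" "z \<in> upper_half_plane"
  then show "L (p1 * p2) (moebius_act (matrix_inv (A_mat (int p2))) z) =
      (of_nat p2 * z + 1)^2 * (E2 z - of_nat p2 / of_nat p1 * E2 ((of_nat p2 * z + 1) / of_nat p1))"
    using L_lower_triangular[of z p1 p2] prime_gt_0_nat
    by (simp add: moebius_act_matrix_inv_A_mat upper_half_plane_def mult.commute)
qed

end
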